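(* Let $(G_n)_{n\geq 1}$ be the sequence of polynomials in one variable $x$ with $G_1=1+x$ and $$(x-1)^2G_{n+1}(x)=(x^{2n+3}+1)G_n(1)-2x^2G_n(x)\qquad (n\geq 1).$$ Then for every $n\geq 1$, all complex roots of $G_n(x)$ lie on the unit circle $\{z\in\mathbb{C}: |z|=1\}$.
   Context: The recurrence determines $G_{n+1}$ uniquely; the right-hand side is always divisible by $(x-1)^2$, so each $G_n$ is a polynomial (palindromic, of degree $2n-1$). E.g. $G_2=2x^3+4x^2+4x+2$. *)

theory Defs
  imports "HOL-Computational_Algebra.Polynomial" Complex_Main
begin

end

theory Submission
  imports Defs
begin

text \<open>
  Palindromic polynomials with nonnegative coefficients are the nonnegative combinations of
  \<open>X\<^sup>i + X\<^sup>d\<^sup>-\<^sup>i\<close>. The recurrence is linear in \<open>G\<^sub>n\<close> and sends such a generator to twice the product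
  of the geometric sums \<open>(1 - X\<^sup>a)/(1 - X)\<close> and \<open>(1 - X\<^sup>b)/(1 - X)\<close>, where \<open>a = i + 2\<close> and
  \<open>b = d - i + 2\<close>. Such a product is again palindromic with nonnegative coefficients, so all
  \<open>G\<^sub>n\<close> are, and up to the factor \<open>(1 - X)\<^sup>2\<close> every \<open>G\<^sub>n\<^sub>+\<^sub>1\<close> is a nonnegative combination of the
  \<open>(1 - X\<^sup>a)(1 - X\<^sup>b)\<close> with \<open>a + b\<close> fixed.
  Dividing by \<open>1 - X\<^sup>a\<^sup>+\<^sup>b\<close>, the quotient \<open>(1 - u)(1 - v)/(1 - u v)\<close> has the inverse
  \<open>1/(1 - u) + 1/(1 - v) - 1\<close>, whose real part is positive inside the unit disc and negative
  outside of it. Hence the combination cannot vanish off the unit circle.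
\<close>

text \<open>The real part is \<open>(1 - Re u) / (cmod (1 - u))\<^sup>2\<close>, and
  \<open>(cmod (1 - u))\<^sup>2 < 2 * (1 - Re u)\<close> rearranges
  \<open>(cmod u)\<^sup>2 < 1\<close>.\<close>

lemma Re_inverse_one_minus_gt_half:
  fixes u :: complex
  assumes "cmod u < 1"
  shows "Re (inverse (1 - u)) > 1 / 2"
proof -
  have "(cmod u)\<^sup>2 < 1"
    using assms by (simp add: abs_square_less_1)
  then have lt: "(Re u)\<^sup>2 + (Im u)\<^sup>2 < 1"
    by (simp add: cmod_power2)
  have "u \<noteq> 1"
    using assms by auto
  then have pos: "(1 - Re u)\<^sup>2 + (Im u)\<^sup>2 > 0"
    by (simp add: complex_eq_iff sum_power2_gt_zero_iff)
  have "(1 - Re u)\<^sup>2 + (Im u)\<^sup>2 < 2 * (1 - Re u)"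
    using lt by (simp add: power2_eq_square algebra_simps)
  then show ?thesis
    using pos by (simp add: pos_less_divide_eq)
qed

lemma Re_mobius_product_pos:
  fixes u v :: complex
  assumes "cmod u < 1" "cmod v < 1"
  shows "Re ((1 - u) * (1 - v) / (1 - u * v)) > 0"
proof -
  let ?w = "inverse (1 - u) + inverse (1 - v) - 1"
  have "cmod (u * v) < 1"
    using assms mult_strict_mono'[of "cmod u" 1 "cmod v" 1] by (simp add: norm_mult)
  then have ne: "1 - u \<noteq> 0" "1 - v \<noteq> 0" "1 - u * v \<noteq> 0"
    using assms by auto
  then have "?w = (1 - u * v) / ((1 - u) * (1 - v))"
    by (simp add: divide_simps) (simp add: algebra_simps)
  then have "(1 - u) * (1 - v) / (1 - u * v) = inverse ?w"
    by simp
  moreover have pos: "Re ?w > 0"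
    using Re_inverse_one_minus_gt_half[OF assms(1)] Re_inverse_one_minus_gt_half[OF assms(2)]
    by (simp only: plus_complex.sel minus_complex.sel one_complex.sel)
  \<comment> \<open>This is the denominator of \<open>Re (inverse ?w)\<close>, so inversion keeps
    the sign of the real part.\<close>
  moreover have "(Re ?w)\<^sup>2 + (Im ?w)\<^sup>2 > 0"
    using pos by (intro add_pos_nonneg) auto
  ultimately show ?thesis
    by (simp only: inverse_complex.sel divide_pos_pos)
qed

text \<open>Replacing \<open>u\<close> and \<open>v\<close> by their inverses negates the quotient,
  which reduces the exterior to the disc.\<close>

lemma Re_mobius_product_neg:
  fixes u v :: complex
  assumes "cmod u > 1" "cmod v > 1"
  shows "Re ((1 - u) * (1 - v) / (1 - u * v)) < 0"
proof -
  have "cmod (inverse u) < 1" "cmod (inverse v) < 1"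
    using assms by (simp_all add: norm_inverse inverse_less_1_iff)
  then have "Re ((1 - inverse u) * (1 - inverse v) / (1 - inverse u * inverse v)) > 0"
    by (rule Re_mobius_product_pos)
  moreover have "cmod (u * v) > 1"
    using assms less_1_mult by (simp add: norm_mult)
  then have ne: "u \<noteq> 0" "v \<noteq> 0" "u * v \<noteq> 1"
    using assms by auto
  then have "(1 - u) * (1 - v) / (1 - u * v)
      = - ((1 - inverse u) * (1 - inverse v) / (1 - inverse u * inverse v))"
    by (simp add: field_simps)
  ultimately show ?thesis
    by simp
qed

lemma smult_sum_right: "smult c (\<Sum>i\<in>A. f i) = (\<Sum>i\<in>A. smult c (f i))"
  by (induction A rule: infinite_finite_induct) (simp_all add: smult_add_right)

text \<open>Stated through generators rather than coefficients, so that a linear recurrence can be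
  applied termwise. \<open>d\<close> is only a formal degree: the zero polynomial qualifies for
  every \<open>d\<close>.\<close>

definition nonneg_palindromic :: "nat \<Rightarrow> complex poly \<Rightarrow> bool" where
  "nonneg_palindromic d p \<longleftrightarrow>
    (\<exists>c. (\<forall>i. 0 \<le> c i) \<and>
      p = (\<Sum>i\<le>d. smult (complex_of_real (c i)) ([:0, 1:] ^ i + [:0, 1:] ^ (d - i))))"

lemma nonneg_palindromic_0: "nonneg_palindromic d 0"
  unfolding nonneg_palindromic_def by (rule exI[of _ "\<lambda>_. 0"]) simp

lemma nonneg_palindromic_add:
  assumes "nonneg_palindromic d p" "nonneg_palindromic d q"
  shows "nonneg_palindromic d (p + q)"
proof -
  obtain b c where bc: "\<forall>i. 0 \<le> b i" "\<forall>i. 0 \<le> c i"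
    "p = (\<Sum>i\<le>d. smult (complex_of_real (b i)) ([:0, 1:] ^ i + [:0, 1:] ^ (d - i)))"
    "q = (\<Sum>i\<le>d. smult (complex_of_real (c i)) ([:0, 1:] ^ i + [:0, 1:] ^ (d - i)))"
    using assms unfolding nonneg_palindromic_def by blast
  show ?thesis
    unfolding nonneg_palindromic_def
    by (rule exI[of _ "\<lambda>i. b i + c i"]) (simp add: bc sum.distrib smult_add_left)
qed

lemma nonneg_palindromic_smult:
  assumes "0 \<le> r" "nonneg_palindromic d p"
  shows "nonneg_palindromic d (smult (complex_of_real r) p)"
proof -
  obtain c where c: "\<forall>i. 0 \<le> c i"
    "p = (\<Sum>i\<le>d. smult (complex_of_real (c i)) ([:0, 1:] ^ i + [:0, 1:] ^ (d - i)))"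
    using assms unfolding nonneg_palindromic_def by blast
  show ?thesis
    unfolding nonneg_palindromic_def
    by (rule exI[of _ "\<lambda>i. r * c i"]) (simp add: c assms(1) smult_sum_right)
qed

lemma nonneg_palindromic_sum:
  assumes "\<And>i. i \<in> A \<Longrightarrow> nonneg_palindromic d (f i)"
  shows "nonneg_palindromic d (\<Sum>i\<in>A. f i)"
  using assms
  by (induction A rule: infinite_finite_induct)
    (auto intro: nonneg_palindromic_0 nonneg_palindromic_add)

lemma nonneg_palindromic_generator:
  assumes "i \<le> d"
  shows "nonneg_palindromic d ([:0, 1:] ^ i + [:0, 1:] ^ (d - i))"
  unfolding nonneg_palindromic_def
proof (intro exI conjI)
  show "\<forall>j. (0::real) \<le> (if j = i then 1 else 0)"
    by simp
  have "(\<Sum>j\<le>d. smult (complex_of_real (if j = i then 1 else 0)) ([:0, 1:] ^ j + [:0, 1:] ^ (d - j)))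
     = (\<Sum>j\<le>d. if j = i then [:0, 1:] ^ j + [:0, 1:] ^ (d - j) else 0)"
    by (intro sum.cong) auto
  then show "[:0, 1:] ^ i + [:0, 1:] ^ (d - i) = (\<Sum>j\<le>d. smult (complex_of_real
      (if j = i then 1 else 0)) ([:0, 1:] ^ j + [:0, 1:] ^ (d - j)))"
    using assms by (simp add: sum.delta)
qed

text \<open>Reversing both sums pairs each \<open>X ^ (i + j)\<close> with
  \<open>X ^ (d - (i + j))\<close>. The factor 2 counts the product once in either order and so
  avoids halves.\<close>

lemma nonneg_palindromic_geometric_product:
  assumes "a + b = d + 2"
  shows "nonneg_palindromic d (smult 2 ((\<Sum>i<a. [:0, 1:] ^ i) * (\<Sum>j<b. [:0, 1:] ^ j)))"
proof -
  let ?X = "[:0, 1:] :: complex poly"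
  let ?P = "(\<Sum>i<a. ?X ^ i) * (\<Sum>j<b. ?X ^ j)"
  have "?P = (\<Sum>i<a. \<Sum>j<b. ?X ^ (i + j))"
    by (simp add: sum_product power_add)
  moreover have "?P = (\<Sum>i<a. ?X ^ (a - Suc i)) * (\<Sum>j<b. ?X ^ (b - Suc j))"
    by (simp only: sum.nat_diff_reindex)
  then have "?P = (\<Sum>i<a. \<Sum>j<b. ?X ^ (a - Suc i) * ?X ^ (b - Suc j))"
    by (simp only: sum_product)
  moreover have "\<dots> = (\<Sum>i<a. \<Sum>j<b. ?X ^ (d - (i + j)))"
  proof (intro sum.cong refl)
    fix i j assume "i \<in> {..<a}" "j \<in> {..<b}"
    then have "(a - Suc i) + (b - Suc j) = d - (i + j)"
      using assms by auto
    then show "?X ^ (a - Suc i) * ?X ^ (b - Suc j) = ?X ^ (d - (i + j))"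
      by (metis power_add)
  qed
  ultimately have "?P + ?P = (\<Sum>i<a. \<Sum>j<b. ?X ^ (i + j) + ?X ^ (d - (i + j)))"
    by (simp only: sum.distrib)
  moreover have "smult 2 ?P = ?P + ?P"
    by (metis one_add_one smult_1_left smult_add_left)
  moreover have "nonneg_palindromic d (\<Sum>i<a. \<Sum>j<b. ?X ^ (i + j) + ?X ^ (d - (i + j)))"
    using assms by (intro nonneg_palindromic_sum nonneg_palindromic_generator) auto
  ultimately show ?thesis
    by simp
qed

text \<open>After division by \<open>1 - z ^ (d + 4)\<close> all nonzero terms have real parts of
  the same strict sign, and the term at \<open>k\<close> is nonzero.\<close>

lemma nonneg_combination_ne_0:
  fixes c :: "nat \<Rightarrow> real" and z :: complex
  assumes "\<And>i. 0 \<le> c i" "k \<le> d" "c k > 0" "cmod z \<noteq> 1"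
  shows "(\<Sum>i\<le>d. complex_of_real (c i) * ((1 - z ^ (i + 2)) * (1 - z ^ (d - i + 2)))) \<noteq> 0"
proof
  let ?t = "\<lambda>i. (1 - z ^ (i + 2)) * (1 - z ^ (d - i + 2)) / (1 - z ^ (d + 4))"
  assume eq: "(\<Sum>i\<le>d. complex_of_real (c i) * ((1 - z ^ (i + 2)) * (1 - z ^ (d - i + 2)))) = 0"
  have t: "?t i = (1 - z ^ (i + 2)) * (1 - z ^ (d - i + 2)) / (1 - z ^ (i + 2) * z ^ (d - i + 2))"
    if "i \<le> d" for i
  proof -
    have "i + 2 + (d - i + 2) = d + 4"
      using that by simp
    then show ?thesis
      by (metis power_add)
  qed
  have "(\<Sum>i\<le>d. complex_of_real (c i) * ?t i) = 0"
    using eq by (simp add: sum_divide_distrib[symmetric])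
  then have "Re (\<Sum>i\<le>d. complex_of_real (c i) * ?t i) = 0"
    by simp
  then have zero: "(\<Sum>i\<le>d. c i * Re (?t i)) = 0"
    by (simp only: Re_sum times_complex.sel Re_complex_of_real Im_complex_of_real
        mult_zero_left diff_zero)
  show False
  proof (cases "cmod z < 1")
    case True
    have pos: "Re (?t i) > 0" if "i \<le> d" for i
      unfolding t[OF that] using True
      by (intro Re_mobius_product_pos) (simp_all only: norm_power power_less_one_iff norm_ge_zero, auto)
    have "(\<Sum>i\<le>d. c i * Re (?t i)) > 0"
    proof (rule sum_pos2[of _ k])
      show "0 < c k * Re (?t k)"
        using assms pos by (intro mult_pos_pos)
      show "0 \<le> c i * Re (?t i)" if "i \<in> {..d}" for i
        using that by (intro mult_nonneg_nonneg assms(1) less_imp_le[OF pos]) simp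
    qed (use assms in simp_all)
    with zero show False by simp
  next
    case False
    then have gt: "cmod z > 1"
      using assms(4) by simp
    have neg: "- Re (?t i) > 0" if "i \<le> d" for i
      unfolding t[OF that] neg_0_less_iff_less
      by (rule Re_mobius_product_neg) (unfold norm_power, (intro one_less_power gt, simp)+)
    have "(\<Sum>i\<le>d. c i * - Re (?t i)) > 0"
    proof (rule sum_pos2[of _ k])
      show "0 < c k * - Re (?t k)"
        using assms neg by (intro mult_pos_pos)
      show "0 \<le> c i * - Re (?t i)" if "i \<in> {..d}" for i
        using that by (intro mult_nonneg_nonneg assms(1) less_imp_le[OF neg]) simp
    qed (use assms in simp_all)
    with zero show False by (simp only: mult_minus_right sum_negf)
  qed
qed

text \<open>One step of the recurrence with \<open>d\<close> for \<open>2 * m - 1\<close>, so that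
  \<open>2 * m + 3\<close> becomes \<open>d + 4\<close>. Both claims come from expanding
  \<open>p\<close> in generators.\<close>

lemma recurrence_step:
  fixes p q :: "complex poly"
  assumes p: "nonneg_palindromic d p" "p \<noteq> 0"
    and q: "[:- 1, 1:] ^ 2 * q =
      smult (poly p 1) (monom 1 (d + 4) + 1) - smult 2 (monom 1 2 * p)"
  shows "nonneg_palindromic (d + 2) q" and "poly q z = 0 \<Longrightarrow> cmod z = 1"
proof -
  let ?X = "[:0, 1:] :: complex poly"
  let ?S = "\<lambda>a. \<Sum>i<a. ?X ^ i"
  obtain c where c: "\<And>i. 0 \<le> c i"
    and p_eq: "p = (\<Sum>i\<le>d. smult (complex_of_real (c i)) (?X ^ i + ?X ^ (d - i)))"
    using p(1) unfolding nonneg_palindromic_def by blast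
  have p1: "poly p 1 = (\<Sum>i\<le>d. 2 * complex_of_real (c i))"
    by (simp add: p_eq poly_sum mult.commute)
  have X: "monom 1 k = ?X ^ k" for k
    by (simp add: monom_altdef)
  \<comment> \<open>The generator weighted by \<open>r\<close> takes the value \<open>2 * r\<close>
    at 1. Its image factors because the exponents \<open>i + 2\<close> and \<open>d - i + 2\<close>
    add up to \<open>d + 4\<close>.\<close>
  have gen: "smult (2 * r) (?X ^ (d + 4) + 1) - smult 2 (?X\<^sup>2 * smult r (?X ^ i + ?X ^ (d - i)))
      = smult (2 * r) ((1 - ?X ^ (i + 2)) * (1 - ?X ^ (d - i + 2)))" if "i \<le> d" for i r
  proof -
    have "d + 4 = (i + 2) + (d - i + 2)"
      using that by simp
    then have "?X ^ (d + 4) = ?X ^ (i + 2) * ?X ^ (d - i + 2)"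
      by (metis power_add)
    then have "smult (2 * r) (?X ^ (d + 4) + 1) - smult (2 * r) (?X ^ (i + 2) + ?X ^ (d - i + 2))
      = smult (2 * r) ((1 - ?X ^ (i + 2)) * (1 - ?X ^ (d - i + 2)))"
      by (simp only: smult_diff_right[symmetric] ring_distribs mult_1_left mult_1_right)
        (simp only: algebra_simps)
    moreover have "smult 2 (?X\<^sup>2 * smult r (?X ^ i + ?X ^ (d - i)))
      = smult (2 * r) (?X ^ (i + 2) + ?X ^ (d - i + 2))"
      by (simp only: mult_smult_right smult_smult power_add distrib_left mult.commute)
    ultimately show ?thesis
      by simp
  qed
  have "smult (poly p 1) (monom 1 (d + 4) + 1) - smult 2 (monom 1 2 * p)
     = (\<Sum>i\<le>d. smult (2 * complex_of_real (c i)) (?X ^ (d + 4) + 1)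
          - smult 2 (?X\<^sup>2 * smult (complex_of_real (c i)) (?X ^ i + ?X ^ (d - i))))"
    unfolding p1 X sum_subtractf smult_sum
    by (simp only: p_eq sum_distrib_left smult_sum_right)
  also have "\<dots> = (\<Sum>i\<le>d. smult (2 * complex_of_real (c i))
      ((1 - ?X ^ (i + 2)) * (1 - ?X ^ (d - i + 2))))"
    by (intro sum.cong refl gen) simp
  finally have q_eq: "[:- 1, 1:] ^ 2 * q = (\<Sum>i\<le>d. smult (2 * complex_of_real (c i))
      ((1 - ?X ^ (i + 2)) * (1 - ?X ^ (d - i + 2))))"
    using q by simp
  have X1: "[:- 1, 1:] ^ 2 = (1 - ?X)\<^sup>2"
    by (simp add: power2_eq_square one_pCons)
  \<comment> \<open>Each factor \<open>1 - X ^ a\<close> is \<open>1 - X\<close> times a geometric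
    sum; the common square is then cancelled.\<close>
  have "(1 - ?X)\<^sup>2 * q = (1 - ?X)\<^sup>2 *
      (\<Sum>i\<le>d. smult (2 * complex_of_real (c i)) (?S (i + 2) * ?S (d - i + 2)))"
    unfolding q_eq[unfolded X1] one_diff_power_eq
      sum_distrib_left[of "(1 - ?X)\<^sup>2"]
    by (intro sum.cong refl) (simp only: mult_smult_right power2_eq_square mult_ac)
  then have q_sum: "q = (\<Sum>i\<le>d. smult (2 * complex_of_real (c i)) (?S (i + 2) * ?S (d - i + 2)))"
    by (simp add: one_pCons)
  have "nonneg_palindromic (d + 2) (smult (complex_of_real (c i)) (smult 2 (?S (i + 2) * ?S (d - i + 2))))"
    if "i \<le> d" for i
    by (intro nonneg_palindromic_smult c nonneg_palindromic_geometric_product) (use that in simp)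
  then show "nonneg_palindromic (d + 2) q"
    unfolding q_sum by (intro nonneg_palindromic_sum) (simp add: mult.commute)
  obtain k where k: "k \<le> d" "c k > 0"
  proof (rule ccontr)
    assume "\<not> thesis"
    then have "\<And>i. i \<le> d \<Longrightarrow> c i = 0"
      using c that by (metis order_le_less)
    then have "p = 0"
      unfolding p_eq by (intro sum.neutral) simp
    with p(2) show False ..
  qed
  assume "poly q z = 0"
  \<comment> \<open>The extra factor adds only the root 1, which lies on the circle, so the product
    form can be used directly.\<close>
  then have "poly ([:- 1, 1:] ^ 2 * q) z = 0"
    by simp
  then have "(\<Sum>i\<le>d. complex_of_real (2 * c i) * ((1 - z ^ (i + 2)) * (1 - z ^ (d - i + 2)))) = 0"
    unfolding q_eq by (simp add: poly_sum)
  then show "cmod z = 1"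
    using nonneg_combination_ne_0[of "\<lambda>i. 2 * c i" k d z] c k by auto
qed

theorem theorem2:
  fixes G :: "nat \<Rightarrow> complex poly" and n :: nat and z :: complex
  assumes G1: "G 1 = [:1, 1:]"
    and G_rec: "\<And>m. m \<ge> 1 \<Longrightarrow>
      [:- 1, 1:] ^ 2 * G (m + 1) =
        smult (poly (G m) 1) (monom 1 (2 * m + 3) + 1) - smult 2 (monom 1 2 * G m)"
    and "n \<ge> 1"
    and "poly (G n) z = 0"
  shows "cmod z = 1"
proof -
  have "nonneg_palindromic (2 * n - 1) (G n) \<and> (\<forall>z. poly (G n) z = 0 \<longrightarrow> cmod z = 1)"
    using \<open>n \<ge> 1\<close>
  proof (induction n rule: nat_induct_at_least)
    case base
    have "cmod w = 1" if "1 + w = 0" for w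
      using that by (metis add_eq_0_iff norm_minus_cancel norm_one)
    then show ?case
      using nonneg_palindromic_generator[of 0 1] by (simp add: G1[simplified] one_pCons)
  next
    case (Suc m)
    have "G m \<noteq> 0"
      \<comment> \<open>The zero polynomial would have the root 0, against the induction hypothesis
        on roots.\<close>
      using Suc.IH by (metis norm_zero poly_0 zero_neq_one)
    moreover have "2 * m + 3 = 2 * m - 1 + 4"
      using Suc.hyps by simp
    ultimately have "nonneg_palindromic (2 * m - 1 + 2) (G (m + 1))"
      and "\<And>w. poly (G (m + 1)) w = 0 \<Longrightarrow> cmod w = 1"
      using recurrence_step[of "2 * m - 1" "G m" "G (m + 1)"] Suc.IH G_rec[OF Suc.hyps] by metis+
    moreover have "2 * m - 1 + 2 = 2 * Suc m - 1"
      using Suc.hyps by simp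
    ultimately show ?case
      by simp
  qed
  with assms(4) show ?thesis
    by blast
qed

end
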